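(* Let $A$ be a commutative approximately unital Banach algebra. Any separable closed ideal in $A$ having a bounded approximate identity in ${\mathfrak r}_A$ is of the form $\overline{xA}$ for some $x\in{\mathfrak F}_A$. Also, if $(x_k)_{k\ge1}$ is a sequence in ${\mathfrak F}_A$, then the closure of $\sum_k \overline{x_kA}$ equals $\overline{zA}$, where $z=\sum_{k=1}^\infty 2^{-k}x_k$.
   Context: Banach algebras are complex with submultiplicative norm; "unital" means identity of norm 1. Approximately unital: has a contractive approximate identity. Multiplier unitization $A^1$: $A$ if unital, otherwise $A+\mathbb{C}1$ with $\|a+\lambda1\|=\sup\{\|ac+\lambda c\|:c\in A,\|c\|\le1\}$. ${\mathfrak F}_A=\{a\in A:\|1-a\|_{A^1}\le1\}$; ${\mathfrak r}_A=\{a\in A:\mathrm{Re}\,\varphi(a)\ge0$ for all $\varphi\in(A^1)^*$ with $\|\varphi\|=\varphi(1)=1\}$. $\overline{xA}$ is the norm closure of $\{xa:a\in A\}$. *)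

theory Defs
  imports "HOL-Analysis.Analysis"
begin

text \<open>A complex Banach algebra is modelled as a type of class
  real_normed_algebra + banach (real Banach algebra, submultiplicative norm)
  together with a complex scalar multiplication extending scaleR, compatible
  with the norm and the multiplication.\<close>

definition complex_scalar ::
  "(complex \<Rightarrow> 'a::{real_normed_algebra,banach} \<Rightarrow> 'a) \<Rightarrow> bool" where
  "complex_scalar cs \<longleftrightarrow>
     (\<forall>c d x. cs (c + d) x = cs c x + cs d x) \<and>
     (\<forall>c x y. cs c (x + y) = cs c x + cs c y) \<and>
     (\<forall>c d x. cs (c * d) x = cs c (cs d x)) \<and>
     (\<forall>r x. cs (complex_of_real r) x = scaleR r x) \<and>
     (\<forall>c x. norm (cs c x) = cmod c * norm x) \<and>
     (\<forall>c x y. cs c (x * y) = cs c x * y \<and> cs c (x * y) = x * cs c y)"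

text \<open>Approximately unital: a contractive approximate identity, given as a
  proper filter on the algebra (the image filter of a net) supported on the
  closed unit ball. Commutativity makes one-sided convergence sufficient.\<close>

definition approx_unital :: "'a::{real_normed_algebra,comm_ring} itself \<Rightarrow> bool" where
  "approx_unital _ \<longleftrightarrow>
     (\<exists>F :: 'a filter. F \<noteq> bot \<and> F \<le> principal {e. norm e \<le> 1} \<and>
        (\<forall>a. ((\<lambda>e. e * a) \<longlongrightarrow> a) F))"

text \<open>Norm of a + lambda 1 in the multiplier unitization A^1.\<close>

definition unorm :: "(complex \<Rightarrow> 'a \<Rightarrow> 'a) \<Rightarrow> 'a::real_normed_algebra \<Rightarrow> complex \<Rightarrow> real" where
  "unorm cs a l = (SUP c\<in>{c. norm c \<le> 1}. norm (a * c + cs l c))"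

definition frakF :: "(complex \<Rightarrow> 'a \<Rightarrow> 'a) \<Rightarrow> 'a::real_normed_algebra set" where
  "frakF cs = {a. unorm cs (- a) 1 \<le> 1}"

text \<open>A state of A^1: phi(a + lambda 1) = f a + lambda, with f complex linear
  on A and |phi| bounded by the unitization norm (so norm phi = phi 1 = 1).\<close>

definition unit_state :: "(complex \<Rightarrow> 'a \<Rightarrow> 'a) \<Rightarrow> ('a::real_normed_algebra \<Rightarrow> complex) \<Rightarrow> bool" where
  "unit_state cs f \<longleftrightarrow>
     (\<forall>x y. f (x + y) = f x + f y) \<and> (\<forall>c x. f (cs c x) = c * f x) \<and>
     (\<forall>a l. cmod (f a + l) \<le> unorm cs a l)"

definition frakr :: "(complex \<Rightarrow> 'a \<Rightarrow> 'a) \<Rightarrow> 'a::real_normed_algebra set" where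
  "frakr cs = {a. \<forall>f. unit_state cs f \<longrightarrow> Re (f a) \<ge> 0}"

definition closed_ideal :: "(complex \<Rightarrow> 'a \<Rightarrow> 'a) \<Rightarrow> 'a::real_normed_algebra set \<Rightarrow> bool" where
  "closed_ideal cs J \<longleftrightarrow> 0 \<in> J \<and> (\<forall>x\<in>J. \<forall>y\<in>J. x + y \<in> J) \<and>
     (\<forall>c. \<forall>x\<in>J. cs c x \<in> J) \<and> (\<forall>a. \<forall>x\<in>J. a * x \<in> J \<and> x * a \<in> J) \<and> closed J"

definition separable_set :: "'a::metric_space set \<Rightarrow> bool" where
  "separable_set J \<longleftrightarrow> (\<exists>D. countable D \<and> D \<subseteq> J \<and> J \<subseteq> closure D)"

definition has_bai_in :: "'a::real_normed_algebra set \<Rightarrow> 'a set \<Rightarrow> bool" where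
  "has_bai_in J S \<longleftrightarrow>
     (\<exists>(F :: 'a filter) M. F \<noteq> bot \<and> F \<le> principal (J \<inter> S \<inter> {e. norm e \<le> M}) \<and>
        (\<forall>j\<in>J. ((\<lambda>e. e * j) \<longlongrightarrow> j) F))"

definition principal_cl :: "'a::real_normed_algebra \<Rightarrow> 'a set" where
  "principal_cl x = closure (range (\<lambda>a. x * a))"

end

theory Submission
  imports Defs
begin

text \<open>Let z be the weighted sum of the x k and T = 1 - z/2. The limit N y of the norms of the iterates
  of T at y is a seminorm that T preserves. As T is a convex combination of the contractions
  1 - (x k)/2, each of these preserves N as well, so U = 1 - x k satisfies N ((1 + U) y) = 2 N y.
  This property passes from U to its square, and (1 + V) (1 - V) = 1 - V V, so N ((1 - V) y) doubles
  each time V is replaced by its square; since it stays bounded by 2 \<parallel>y\<parallel>, N (x k y) = 0. Every iterate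
  of T moves x k y only by an element of z A, so x k y lies in the closure of z A.

  For an ideal J with approximate identity in the real positive cone, a / (1 + a) lies in J and in
  the set F, and it generates the same ideal as a, for every a in J with a real positive. Separability
  leaves countably many such generators, to which the second part applies. That 1 + a is invertible
  with contractive inverse is the Lumer-Phillips argument, where the Hahn-Banach theorem (obtained
  from minimal sublinear functionals) supplies the states.\<close>

section \<open>Hahn-Banach theorem by minimal sublinear functionals\<close>

definition sublinear :: "('a::real_vector \<Rightarrow> real) \<Rightarrow> bool" where
  "sublinear p \<longleftrightarrow> (\<forall>x y. p (x + y) \<le> p x + p y) \<and> (\<forall>r>0. \<forall>x. p (r *\<^sub>R x) \<le> r * p x)"

lemma sublinear_zero:
  assumes "sublinear p"
  shows "p 0 = 0"
proof -
  have "p (2 *\<^sub>R 0) \<le> 2 * p 0" "p ((1/2) *\<^sub>R 0) \<le> (1/2) * p 0"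
    using assms unfolding sublinear_def by (metis zero_less_numeral, metis half_gt_zero zero_less_one)
  then show ?thesis by simp
qed

text \<open>The inequality reverse to the defining one results from using that one with the factor
  1/r on the vector \<open>r *\<^sub>R x\<close>.\<close>

lemma sublinear_scale:
  assumes "sublinear p" "r \<ge> 0"
  shows "p (r *\<^sub>R x) = r * p x"
proof (cases "r = 0")
  case True
  then show ?thesis using sublinear_zero[OF assms(1)] by simp
next
  case False
  then have r: "r > 0" using assms by simp
  have "p (inverse r *\<^sub>R (r *\<^sub>R x)) \<le> inverse r * p (r *\<^sub>R x)"
    using assms(1) r unfolding sublinear_def by (meson positive_imp_inverse_positive)
  then have "r * p x \<le> p (r *\<^sub>R x)"
    using r by (simp add: field_simps)
  moreover have "p (r *\<^sub>R x) \<le> r * p x"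
    using assms(1) r unfolding sublinear_def by blast
  ultimately show ?thesis by simp
qed

lemma sublinear_lower:
  assumes "sublinear p"
  shows "- p (- x) \<le> p x"
proof -
  have "p (x + - x) \<le> p x + p (- x)"
    using assms unfolding sublinear_def by blast
  then show ?thesis using sublinear_zero[OF assms] by simp
qed

text \<open>Shows that a minimal sublinear functional is odd, and forces every linear functional
  below q to agree with p at y. In the infimum over t \<ge> 0 of
  \<open>p (x + t *\<^sub>R y) - t * p y\<close>, the value t = 0 gives the bound by p and t = 1 the
  bound at \<open>- y\<close>.\<close>

lemma sublinear_reduce:
  fixes p :: "'a::real_vector \<Rightarrow> real"
  assumes p: "sublinear p"
  obtains q where "sublinear q" "\<And>x. q x \<le> p x" "q (- y) \<le> - p y"
proof -
  define f where "f = (\<lambda>x t. p (x + t *\<^sub>R y) - t * p y)"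
  define q where "q = (\<lambda>x. INF t\<in>{0..}. f x t)"
  have sub: "p (u + v) \<le> p u + p v" for u v
    using p unfolding sublinear_def by blast
  \<comment> \<open>Subadditivity against \<open>- x\<close> leaves p (t y) = t p y, which cancels
    the subtracted term, so the infimum is finite.\<close>
  have "- p (- x) \<le> f x t" if "t \<ge> 0" for x t
  proof -
    have "p ((x + t *\<^sub>R y) + - x) \<le> p (x + t *\<^sub>R y) + p (- x)" by (rule sub)
    then show ?thesis using sublinear_scale[OF p that] by (simp add: f_def)
  qed
  then have bdd: "bdd_below (f x ` {0..})" for x
    by (intro bdd_belowI2) auto
  have le: "q x \<le> f x t" if "t \<ge> 0" for x t
    unfolding q_def using that by (intro cINF_lower bdd) auto
  have ge: "B \<le> q x" if "\<And>t. t \<ge> 0 \<Longrightarrow> B \<le> f x t" for B x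
    unfolding q_def using that by (intro cINF_greatest) auto
  have "sublinear q"
    unfolding sublinear_def
  proof (intro conjI allI impI)
    fix u v
    have "q (u + v) - f v t \<le> q u" if t: "t \<ge> 0" for t
    proof (rule ge)
      fix s :: real assume s: "s \<ge> 0"
      have "p ((u + s *\<^sub>R y) + (v + t *\<^sub>R y)) \<le> p (u + s *\<^sub>R y) + p (v + t *\<^sub>R y)"
        by (rule sub)
      then have "f (u + v) (s + t) \<le> f u s + f v t"
        by (simp add: f_def algebra_simps)
      then show "q (u + v) - f v t \<le> f u s"
        using le[of "s + t" "u + v"] s t by simp
    qed
    then have "q (u + v) - q u \<le> q v"
      by (intro ge) (simp add: algebra_simps)
    then show "q (u + v) \<le> q u + q v" by simp
  next
    fix r :: real and x assume r: "r > 0"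
    have "q (r *\<^sub>R x) / r \<le> q x"
    proof (rule ge)
      fix t :: real assume t: "t \<ge> 0"
      have "f (r *\<^sub>R x) (r * t) = r * f x t"
        using sublinear_scale[OF p less_imp_le[OF r], of "x + t *\<^sub>R y"]
        by (simp add: f_def algebra_simps)
      then have "q (r *\<^sub>R x) \<le> r * f x t"
        using le[of "r * t" "r *\<^sub>R x"] r t by simp
      then show "q (r *\<^sub>R x) / r \<le> f x t" using r by (simp add: field_simps)
    qed
    then show "q (r *\<^sub>R x) \<le> r * q x" using r by (simp add: field_simps)
  qed
  moreover have "q x \<le> p x" for x
    using le[of 0 x] by (simp add: f_def)
  moreover have "q (- y) \<le> - p y"
    using le[of 1 "- y"] sublinear_zero[OF p] by (simp add: f_def)
  ultimately show ?thesis by (rule that)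
qed

text \<open>Supplies the chain bounds for Zorn's lemma. The common majorant \<open>p0\<close> keeps
  the pointwise infimum finite, since p x \<ge> - p (- x) \<ge> - p0 (- x).\<close>

lemma sublinear_chain_INF:
  fixes C :: "('a::real_vector \<Rightarrow> real) set"
  assumes "C \<noteq> {}" and sl: "\<And>p. p \<in> C \<Longrightarrow> sublinear p"
    and chain: "\<And>p q. p \<in> C \<Longrightarrow> q \<in> C \<Longrightarrow> p \<le> q \<or> q \<le> p"
    and bound: "\<And>p x. p \<in> C \<Longrightarrow> p x \<le> p0 x"
  obtains u where "sublinear u" "\<And>p. p \<in> C \<Longrightarrow> u \<le> p"
proof -
  define u where "u = (\<lambda>x. INF p\<in>C. p x)"
  have "- p0 (- x) \<le> p x" if "p \<in> C" for p x
    using sublinear_lower[OF sl[OF that], of x] bound[OF that, of "- x"] by simp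
  then have bdd: "bdd_below ((\<lambda>p. p x) ` C)" for x
    by (intro bdd_belowI2) auto
  have le: "u x \<le> p x" if "p \<in> C" for x p
    unfolding u_def using that by (intro cINF_lower bdd) auto
  have ge: "B \<le> u x" if "\<And>p. p \<in> C \<Longrightarrow> B \<le> p x" for B x
    unfolding u_def using that assms(1) by (intro cINF_greatest) auto
  have "sublinear u"
    unfolding sublinear_def
  proof (intro conjI allI impI)
    fix x y
    have "u (x + y) - q y \<le> u x" if q: "q \<in> C" for q
    proof (rule ge)
      fix p assume p: "p \<in> C"
      \<comment> \<open>The chain condition enters here: both p and q are replaced by the smaller of
        the two, whose own subadditivity applies.\<close>
      obtain r where r: "r \<in> C" "r \<le> p" "r \<le> q" using chain[OF p q] p q by blast
      have "u (x + y) \<le> r (x + y)" by (rule le[OF r(1)])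
      also have "\<dots> \<le> r x + r y" using sl[OF r(1)] unfolding sublinear_def by blast
      also have "\<dots> \<le> p x + q y" using r by (intro add_mono) (auto simp: le_fun_def)
      finally show "u (x + y) - q y \<le> p x" by simp
    qed
    then have "u (x + y) - u x \<le> u y"
      by (intro ge) (simp add: algebra_simps)
    then show "u (x + y) \<le> u x + u y" by simp
  next
    fix r :: real and x assume r: "r > 0"
    have "u (r *\<^sub>R x) / r \<le> u x"
    proof (rule ge)
      fix p assume p: "p \<in> C"
      have "u (r *\<^sub>R x) \<le> r * p x"
        using le[OF p, of "r *\<^sub>R x"] sublinear_scale[OF sl[OF p], of r x] r by simp
      then show "u (r *\<^sub>R x) / r \<le> p x" using r by (simp add: field_simps)
    qed
    then show "u (r *\<^sub>R x) \<le> r * u x" using r by (simp add: field_simps)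
  qed
  then show ?thesis using that le by (auto simp: le_fun_def)
qed

text \<open>A minimal sublinear functional below p is odd by \<open>sublinear_reduce\<close>, and an
  odd sublinear functional is linear.\<close>

lemma linear_below_sublinear:
  fixes p :: "'a::real_vector \<Rightarrow> real"
  assumes p: "sublinear p"
  obtains g where "linear g" "\<And>x. g x \<le> p x"
proof -
  define S where "S = {q. sublinear q \<and> q \<le> p}"
  let ?P = "\<lambda>q r :: 'a \<Rightarrow> real. r \<le> q"
  have "\<exists>m\<in>S. \<forall>q\<in>S. q \<le> m \<longrightarrow> q = m"
  \<comment> \<open>The order is reversed: the maximal elements of Zorn's lemma are minimal
    functionals, and upper bounds of chains are pointwise lower bounds.\<close>
  proof (rule predicate_Zorn[where P = ?P])
    show "partial_order_on S (relation_of ?P S)"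
      by (intro partial_order_on_relation_ofI) auto
    show "\<exists>u\<in>S. \<forall>q\<in>C. u \<le> q" if C: "C \<in> Chains (relation_of ?P S)" for C
    proof (cases "C = {}")
      case True
      then show ?thesis using p by (auto simp: S_def)
    next
      case False
      have CS: "C \<subseteq> S" and chain: "\<And>q r. q \<in> C \<Longrightarrow> r \<in> C \<Longrightarrow> q \<le> r \<or> r \<le> q"
        using C by (auto simp: Chains_def relation_of_def)
      obtain u where u: "sublinear u" "\<And>q. q \<in> C \<Longrightarrow> u \<le> q"
      proof (rule sublinear_chain_INF[OF False])
        show "sublinear q" "q x \<le> p x" if "q \<in> C" for q x
          using CS that by (auto simp: S_def le_fun_def)
      qed (use chain that in auto)
      obtain q where q: "q \<in> C" using False by blast
      have "u \<le> p" using u(2)[OF q] q CS by (auto simp: S_def intro: order_trans)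
      then show ?thesis using u by (auto simp: S_def)
    qed
  qed
  then obtain g where g: "sublinear g" "g \<le> p" and min: "\<And>q. sublinear q \<Longrightarrow> q \<le> g \<Longrightarrow> q = g"
    by (auto simp: S_def intro: order_trans)
  have neg: "g (- y) = - g y" for y
  proof -
    obtain q where q: "sublinear q" "\<And>x. q x \<le> g x" "q (- y) \<le> - g y"
      using sublinear_reduce[OF g(1)] by blast
    then have "q = g" by (intro min) (auto simp: le_fun_def)
    then show ?thesis using q(3) sublinear_lower[OF g(1), of y] by simp
  qed
  have sub: "g (x + y) \<le> g x + g y" for x y
    using g(1) unfolding sublinear_def by blast
  have "linear g"
  proof (rule linearI)
    fix x y
    show "g (x + y) = g x + g y"
      \<comment> \<open>As g is odd, the second instance reads g x \<le> g (x + y) - g y.\<close>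
      using sub[of x y] sub[of "x + y" "- y"] neg[of y] by simp
  next
    fix r x
    show "g (r *\<^sub>R x) = r *\<^sub>R g x"
    proof (cases "r \<ge> 0")
      case True
      then show ?thesis using sublinear_scale[OF g(1)] by simp
    next
      case False
      then have "g ((- r) *\<^sub>R x) = (- r) * g x"
        using sublinear_scale[OF g(1), of "- r" x] by simp
      then show ?thesis using neg[of "r *\<^sub>R x"] by simp
    qed
  qed
  then show ?thesis using g(2) that by (auto simp: le_fun_def)
qed

text \<open>Reducing the norm in the direction y first forces any linear g below the reduced
  functional to satisfy g (- y) \<le> - norm y, hence to attain the norm at y.\<close>

lemma norming_functional:
  fixes y :: "'a::real_normed_vector"
  obtains g where "linear g" "\<And>x. g x \<le> norm x" "g y = norm y"
proof -
  have "sublinear (norm :: 'a \<Rightarrow> real)"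
    by (auto simp: sublinear_def norm_triangle_ineq)
  then obtain q where q: "sublinear q" "\<And>x. q x \<le> norm x" "q (- y) \<le> - norm y"
    using sublinear_reduce by blast
  obtain g where g: "linear g" "\<And>x. g x \<le> q x"
    using linear_below_sublinear[OF q(1)] by blast
  have le: "g x \<le> norm x" for x using g(2)[of x] q(2)[of x] by simp
  have "g (- y) \<le> - norm y" using g(2)[of "- y"] q(3) by simp
  then have "g y = norm y" using le[of y] linear_neg[OF g(1), of y] by simp
  with g(1) le show ?thesis by (rule that)
qed

text \<open>The functional h x = g x - i g (i x) is complex linear with the real norming functional
  g as its real part. Rotating h u onto the positive axis turns the bound on g into one on the
  modulus of h.\<close>

lemma complex_norming_functional:
  fixes cs :: "complex \<Rightarrow> 'a::{real_normed_algebra,banach} \<Rightarrow> 'a" and y :: 'a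
  assumes cs: "complex_scalar cs"
  obtains h :: "'a \<Rightarrow> complex" where "\<And>u v. h (u + v) = h u + h v" "\<And>c u. h (cs c u) = c * h u"
    "\<And>u. cmod (h u) \<le> norm u" "h y = complex_of_real (norm y)"
proof -
  obtain g where g: "linear g" and le: "\<And>x. g x \<le> norm x" and gy: "g y = norm y"
    using norming_functional[of y] by blast
  have cadd: "cs (c + d) x = cs c x + cs d x" and addc: "cs c (x + x') = cs c x + cs c x'"
    and cmul: "cs (c * d) x = cs c (cs d x)" and creal: "cs (complex_of_real r) x = r *\<^sub>R x"
    and cnorm: "norm (cs c x) = cmod c * norm x" for c d x x' r
    using cs unfolding complex_scalar_def by blast+
  have split: "cs c x = Re c *\<^sub>R x + Im c *\<^sub>R cs \<i> x" for c x
  proof -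
    have "cs c x = cs (complex_of_real (Re c) + complex_of_real (Im c) * \<i>) x"
      by (rule arg_cong[where f = "\<lambda>d. cs d x"]) (simp add: complex_eq_iff)
    then show ?thesis by (simp only: cadd cmul creal)
  qed
  have gcs: "g (cs c x) = Re c * g x + Im c * g (cs \<i> x)" for c x
    by (subst split) (simp add: linear_add[OF g] linear_scale[OF g])
  define h where "h = (\<lambda>x. Complex (g x) (- g (cs \<i> x)))"
  have hadd: "h (u + v) = h u + h v" for u v
    by (simp add: h_def addc linear_add[OF g] complex_eq_iff)
  have hscale: "h (cs c u) = c * h u" for c u
  proof -
    have "g (cs \<i> (cs c u)) = Re (\<i> * c) * g u + Im (\<i> * c) * g (cs \<i> u)"
      using gcs[of "\<i> * c" u] by (simp only: cmul)
    then show ?thesis by (simp add: h_def gcs[of c u] complex_eq_iff)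
  qed
  have hle: "cmod (h u) \<le> norm u" for u
  proof -
    obtain w where w: "cmod w = 1" "w * h u = complex_of_real (cmod (h u))"
    proof (cases "h u = 0")
      case True
      then show ?thesis using that[of 1] by simp
    next
      case False
      then show ?thesis
        using that[of "complex_of_real (cmod (h u)) / h u"] by (simp add: norm_divide)
    qed
    have "cmod (h u) = Re (h (cs w u))" by (simp add: hscale w)
    also have "\<dots> \<le> norm (cs w u)" using le by (simp add: h_def)
    finally show ?thesis by (simp add: cnorm w)
  qed
  have "Re (h y) = norm y" by (simp add: h_def gy)
  \<comment> \<open>The modulus of h y is at most norm y, which the real part alone already
    reaches.\<close>
  moreover have "Im (h y) = 0"
  proof -
    have "(Re (h y))\<^sup>2 + (Im (h y))\<^sup>2 \<le> (norm y)\<^sup>2"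
      using power_mono[OF hle[of y], of 2] by (simp add: cmod_power2)
    then show ?thesis using \<open>Re (h y) = norm y\<close> by simp
  qed
  ultimately have "h y = complex_of_real (norm y)" by (simp add: complex_eq_iff)
  with hadd hscale hle show ?thesis by (rule that)
qed

section \<open>The unitization norm: \<open>frakF\<close> as contractive multipliers,
  \<open>frakr\<close> as accretive ones\<close>

lemma unorm_upper:
  fixes cs :: "complex \<Rightarrow> 'a::{real_normed_algebra,banach} \<Rightarrow> 'a"
  assumes cs: "complex_scalar cs" and "norm c \<le> 1"
  shows "norm (a * c + cs l c) \<le> unorm cs a l"
proof -
  have cnorm: "norm (cs l x) = cmod l * norm x" for x
    using cs unfolding complex_scalar_def by blast
  \<comment> \<open>Boundedness makes the real-valued \<open>SUP\<close> a true supremum instead of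
    an unspecified value.\<close>
  have "norm (a * x + cs l x) \<le> norm a + cmod l" if "norm x \<le> 1" for x
  proof -
    have "norm (a * x + cs l x) \<le> norm a * norm x + cmod l * norm x"
      using norm_triangle_mono[OF norm_mult_ineq order_refl] by (metis cnorm)
    also have "\<dots> \<le> norm a * 1 + cmod l * 1"
      using that by (intro add_mono mult_left_mono) auto
    finally show ?thesis by simp
  qed
  then have "bdd_above ((\<lambda>x. norm (a * x + cs l x)) ` {x. norm x \<le> 1})"
    by (intro bdd_aboveI2) auto
  then show ?thesis
    unfolding unorm_def using assms(2) by (intro cSUP_upper) auto
qed

text \<open>On 1 - x, \<open>unorm\<close> is the operator norm of multiplication by 1 - x on the
  algebra, and homogeneity removes the restriction to the unit ball. Later uses of
  \<open>frakF\<close> go through this form.\<close>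

lemma mem_frakF_iff:
  fixes cs :: "complex \<Rightarrow> 'a::{real_normed_algebra,banach} \<Rightarrow> 'a"
  assumes cs: "complex_scalar cs"
  shows "x \<in> frakF cs \<longleftrightarrow> (\<forall>c. norm (c - x * c) \<le> norm c)"
proof -
  have "cs (complex_of_real 1) c = 1 *\<^sub>R c" for c
    using cs unfolding complex_scalar_def by blast
  then have one: "cs 1 c = c" for c by simp
  show ?thesis
  proof
    assume "x \<in> frakF cs"
    then have un: "unorm cs (- x) 1 \<le> 1" by (simp add: frakF_def)
    show "\<forall>c. norm (c - x * c) \<le> norm c"
    proof
      fix c
      show "norm (c - x * c) \<le> norm c"
      proof (cases "c = 0")
        case False
        define u where "u = inverse (norm c) *\<^sub>R c"
        have c: "c = norm c *\<^sub>R u" and "norm u \<le> 1" using False by (auto simp: u_def)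
        then have "norm (u - x * u) \<le> 1"
          using unorm_upper[OF cs, of u "- x" 1] un one by simp
        moreover have "c - x * c = norm c *\<^sub>R (u - x * u)"
          by (subst (1 2) c) (simp add: algebra_simps)
        ultimately show ?thesis by (simp add: mult_left_le)
      qed simp
    qed
  next
    assume *: "\<forall>c. norm (c - x * c) \<le> norm c"
    have "unorm cs (- x) 1 \<le> 1"
      unfolding unorm_def
    proof (rule cSUP_least)
      show "{c::'a. norm c \<le> 1} \<noteq> {}" by (metis (mono_tags) empty_iff mem_Collect_eq norm_zero zero_le_one)
      show "norm (- x * c + cs 1 c) \<le> 1" if "c \<in> {c. norm c \<le> 1}" for c
        using that *[rule_format, of c] by (simp add: one)
    qed
    then show "x \<in> frakF cs" by (simp add: frakF_def)
  qed
qed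

text \<open>If h norms y then b \<mapsto> h (b y) / \<parallel>y\<parallel> is a state, so Re h (a y) \<ge> 0.\<close>

lemma frakr_accretive:
  fixes cs :: "complex \<Rightarrow> 'a::{real_normed_algebra,banach} \<Rightarrow> 'a"
  assumes cs: "complex_scalar cs" and a: "a \<in> frakr cs"
  shows "r * norm y \<le> norm (r *\<^sub>R y + a * y)"
proof (cases "y = 0")
  case False
  define u where "u = inverse (norm y) *\<^sub>R y"
  have nu: "norm u = 1" and y: "y = norm y *\<^sub>R u" using False by (auto simp: u_def)
  obtain h :: "'a \<Rightarrow> complex" where hadd: "\<And>u v. h (u + v) = h u + h v"
    and hscale: "\<And>c u. h (cs c u) = c * h u" and hle: "\<And>u. cmod (h u) \<le> norm u"
    and hu: "h u = complex_of_real (norm u)"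
    using complex_norming_functional[OF cs, of u] by blast
  have cmult: "cs c (v * w) = cs c v * w" and creal: "cs (complex_of_real s) v = s *\<^sub>R v" for c v w s
    using cs unfolding complex_scalar_def by blast+
  have "unit_state cs (\<lambda>b. h (b * u))"
    unfolding unit_state_def
  proof (intro conjI allI)
    show "h ((v + w) * u) = h (v * u) + h (w * u)" for v w
      by (simp add: distrib_right hadd)
    show "h (cs c v * u) = c * h (v * u)" for c v
      by (simp add: hscale flip: cmult)
    show "cmod (h (b * u) + l) \<le> unorm cs b l" for b l
    proof -
      have "h (b * u) + l = h (b * u + cs l u)" by (simp add: hadd hscale hu nu)
      then have "cmod (h (b * u) + l) \<le> norm (b * u + cs l u)" using hle by simp
      also have "\<dots> \<le> unorm cs b l" using nu by (intro unorm_upper[OF cs]) simp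
      finally show ?thesis .
    qed
  qed
  then have "0 \<le> Re (h (a * u))" using a unfolding frakr_def by blast
  then have "r \<le> Re (h (r *\<^sub>R u + a * u))"
    using hscale[of "complex_of_real r" u] by (simp add: hadd creal hu nu)
  also have "\<dots> \<le> norm (r *\<^sub>R u + a * u)"
    using complex_Re_le_cmod hle order_trans by blast
  finally have "r \<le> norm (r *\<^sub>R u + a * u)" .
  then have "r * norm y \<le> norm y * norm (r *\<^sub>R u + a * u)"
    by (metis mult.commute mult_left_mono norm_ge_zero)
  also have "\<dots> = norm (norm y *\<^sub>R (r *\<^sub>R u + a * u))" by simp
  also have "norm y *\<^sub>R (r *\<^sub>R u + a * u) = r *\<^sub>R y + a * y"
    using y by (metis mult_scaleR_right scaleR_add_right scaleR_left_commute)
  finally show ?thesis .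
qed simp

section \<open>Solving for a / (1 + a) by continuation in the parameter r\<close>

text \<open>The element b solving r b + a b = a is a / (r + a); by accretivity 1 - b = r / (r + a)
  is a contraction, so solvability propagates from r to every s with |r - s| < r.\<close>

lemma accretive_quotient_contractive:
  fixes a :: "'a::{real_normed_algebra,comm_ring}"
  assumes acc: "\<And>y. r * norm y \<le> norm (r *\<^sub>R y + a * y)"
    and r: "r > 0" and b: "r *\<^sub>R b + a * b = a"
  shows "norm (c - b * c) \<le> norm c"
proof -
  have "r *\<^sub>R (c - b * c) + a * (c - b * c) = r *\<^sub>R c + a * c - (r *\<^sub>R b + a * b) * c"
    by (simp add: algebra_simps)
  then have "r *\<^sub>R (c - b * c) + a * (c - b * c) = r *\<^sub>R c" using b by simp
  then have "r * norm (c - b * c) \<le> r * norm c"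
    using acc[of "c - b * c"] r by simp
  then show ?thesis using r by simp
qed

lemma accretive_quotient_step:
  fixes a :: "'a::{real_normed_algebra,comm_ring,banach}"
  assumes acc: "\<And>y. r * norm y \<le> norm (r *\<^sub>R y + a * y)"
    and r: "r > 0" and b: "r *\<^sub>R b + a * b = a" and s: "\<bar>r - s\<bar> < r"
  shows "\<exists>b'. s *\<^sub>R b' + a * b' = a"
proof -
  define t where "t = (r - s) / r"
  have t: "\<bar>t\<bar> < 1" using r s by (simp add: t_def)
  \<comment> \<open>The equation s x + a x = a says (r + a) x = a + (r - s) x. Dividing by r + a,
    with a / (r + a) = b and 1 / (r + a) = (1 - b) / r, gives the fixed-point form x = b + t (1 - b)
    x, which contracts by |t|.\<close>
  define f where "f = (\<lambda>x. b + t *\<^sub>R (x - b * x))"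
  have "\<exists>!x. f x = x"
  proof (rule banach_fix_type[of "\<bar>t\<bar>"])
    show "\<forall>x y. dist (f x) (f y) \<le> \<bar>t\<bar> * dist x y"
    proof (intro allI)
      fix x y
      have "f x - f y = t *\<^sub>R ((x - y) - b * (x - y))" by (simp add: f_def algebra_simps)
      then have "dist (f x) (f y) = \<bar>t\<bar> * norm ((x - y) - b * (x - y))" by (simp add: dist_norm)
      also have "\<dots> \<le> \<bar>t\<bar> * dist x y"
        using accretive_quotient_contractive[OF acc r b, of "x - y"]
        by (simp add: dist_norm mult_left_mono)
      finally show "dist (f x) (f y) \<le> \<bar>t\<bar> * dist x y" .
    qed
  qed (use t in auto)
  then obtain x where x: "f x = x" by blast
  have "r *\<^sub>R f x + a * f x
      = (r *\<^sub>R b + a * b) + (r * t) *\<^sub>R x + t *\<^sub>R (a * x - (r *\<^sub>R b + a * b) * x)"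
    by (simp add: f_def algebra_simps)
  also have "\<dots> = a + (r - s) *\<^sub>R x" using b r by (simp add: t_def)
  finally have "s *\<^sub>R x + a * x = a" unfolding x by (simp add: algebra_simps)
  then show ?thesis by blast
qed

text \<open>For r beyond the norm of a this is a Neumann series argument: x = (a - a x) / r has
  contraction constant \<open>norm a / r\<close>.\<close>

lemma accretive_quotient_start:
  fixes a :: "'a::{real_normed_algebra,comm_ring,banach}"
  assumes r: "norm a < r"
  shows "\<exists>b. r *\<^sub>R b + a * b = a"
proof -
  have r0: "r > 0" using r norm_ge_zero[of a] by linarith
  define f where "f = (\<lambda>x. inverse r *\<^sub>R (a - a * x))"
  have "\<exists>!x. f x = x"
  proof (rule banach_fix_type[of "norm a / r"])
    show "\<forall>x y. dist (f x) (f y) \<le> norm a / r * dist x y"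
    proof (intro allI)
      fix x y
      have "f x - f y = - (inverse r *\<^sub>R (a * (x - y)))" by (simp add: f_def algebra_simps)
      then have "dist (f x) (f y) = inverse r * norm (a * (x - y))" using r0 by (simp add: dist_norm)
      also have "\<dots> \<le> inverse r * (norm a * norm (x - y))"
        using r0 by (intro mult_left_mono norm_mult_ineq) auto
      finally show "dist (f x) (f y) \<le> norm a / r * dist x y" by (simp add: dist_norm field_simps)
    qed
  qed (use r r0 in auto)
  then obtain x where x: "f x = x" by blast
  have "r *\<^sub>R f x = a - a * x" using r0 by (simp add: f_def)
  then have "r *\<^sub>R x + a * x = a" unfolding x by simp
  then show ?thesis by blast
qed

lemma accretive_quotient_exists:
  fixes a :: "'a::{real_normed_algebra,comm_ring,banach}"
  assumes acc: "\<And>r y. r * norm y \<le> norm (r *\<^sub>R y + a * y)"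
  shows "\<exists>b. b + a * b = a"
proof -
  \<comment> \<open>Start at a power of 3/2 above the norm of a and descend to (3/2)^0 = 1. Each
    descent from r goes to s = 2r/3, within the admissible distance because |r - s| = r/3.\<close>
  obtain n where n: "norm a < (3/2 :: real) ^ n"
    using real_arch_pow[of "3/2" "norm a"] by auto
  have "\<exists>b. ((3/2 :: real) ^ m) *\<^sub>R b + a * b = a" if "m \<le> n" for m
    using that
  proof (induction rule: inc_induct)
    case base
    show ?case by (rule accretive_quotient_start[OF n])
  next
    case (step m)
    then obtain b where b: "((3/2 :: real) ^ Suc m) *\<^sub>R b + a * b = a" by blast
    show ?case
      by (rule accretive_quotient_step[OF acc _ b]) auto
  qed
  from this[of 0] show ?thesis by simp
qed

lemma frakr_quotient_in_frakF:
  fixes cs :: "complex \<Rightarrow> 'a::{real_normed_algebra,comm_ring,banach} \<Rightarrow> 'a"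
  assumes cs: "complex_scalar cs" and a: "a \<in> frakr cs"
  obtains b where "b \<in> frakF cs" "b + a * b = a"
proof -
  obtain b where b: "b + a * b = a"
    using accretive_quotient_exists[OF frakr_accretive[OF cs a]] by blast
  have "norm (c - b * c) \<le> norm c" for c
    using accretive_quotient_contractive[of 1 a b c] frakr_accretive[OF cs a, of 1] b by simp
  then have "b \<in> frakF cs" by (simp add: mem_frakF_iff[OF cs])
  with b show ?thesis by (intro that)
qed

section \<open>The limit seminorm of the iterates and its vanishing on multiples of x\<close>

lemma seminorm_doubling_vanishes:
  fixes N :: "'a::real_normed_vector \<Rightarrow> real" and U :: "'a \<Rightarrow> 'a"
  assumes Nadd: "\<And>x y. N (x + y) \<le> N x + N y" and Nscale: "\<And>r y. N (r *\<^sub>R y) = \<bar>r\<bar> * N y"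
    and Nle: "\<And>y. N y \<le> norm y" and N0: "\<And>y. 0 \<le> N y"
    and lin: "linear U" and Unorm: "\<And>y. norm (U y) \<le> norm y" and UN: "\<And>y. N (U y) \<le> N y"
    and dbl: "\<And>y. 2 * N y \<le> N (y + U y)"
  shows "N (y - U y) = 0"
proof -
  \<comment> \<open>V is U iterated 2^k times, built by repeated squaring. The conjuncts are what
    squaring preserves, except the last, whose factor doubles.\<close>
  have ex: "\<exists>V. linear V \<and> (\<forall>y. norm (V y) \<le> norm y \<and> N (V y) \<le> N y \<and> 2 * N y \<le> N (y + V y)
        \<and> 2 ^ k * N (y - U y) \<le> N (y - V y))" for k :: nat
  proof (induction k)
    case 0
    show ?case by (rule exI[of _ U]) (simp add: lin Unorm UN dbl)
  next
    case (Suc k)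
    then obtain V where V: "linear V" "\<And>y. norm (V y) \<le> norm y" "\<And>y. N (V y) \<le> N y"
        "\<And>y. 2 * N y \<le> N (y + V y)" "\<And>y. 2 ^ k * N (y - U y) \<le> N (y - V y)"
      by blast
    show ?case
    proof (intro exI[of _ "V \<circ> V"] conjI allI)
      show "linear (V \<circ> V)" using V(1) by (simp add: linear_compose)
      fix y
      show "norm ((V \<circ> V) y) \<le> norm y" using V(2)[of y] V(2)[of "V y"] by simp
      show "N ((V \<circ> V) y) \<le> N y" using V(3)[of y] V(3)[of "V y"] by simp
      \<comment> \<open>This is (1 + V)^2 = (1 + V V) + 2 V. The left side has seminorm at least 4 N
        y and the term 2 V y at most 2 N y, which leaves 2 N y for 1 + V V.\<close>
      have "(y + V y) + V (y + V y) = (y + V (V y)) + 2 *\<^sub>R V y"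
        by (simp add: linear_add[OF V(1)] scaleR_2)
      then have "2 * N (y + V y) \<le> N (y + V (V y)) + 2 * N (V y)"
        using V(4)[of "y + V y"] Nadd[of "y + V (V y)" "2 *\<^sub>R V y"] Nscale[of 2 "V y"]
        by (metis abs_numeral order_trans)
      then show "2 * N y \<le> N (y + (V \<circ> V) y)"
        using V(4)[of y] V(3)[of y] by simp
      have "y - V (V y) = (y - V y) + V (y - V y)" by (simp add: linear_diff[OF V(1)])
      then have "2 * N (y - V y) \<le> N (y - V (V y))" using V(4)[of "y - V y"] by metis
      then show "2 ^ Suc k * N (y - U y) \<le> N (y - (V \<circ> V) y)"
        using V(5)[of y] by simp
    qed
  qed
  have bound: "2 ^ k * N (y - U y) \<le> 2 * norm y" for k :: nat
  proof -
    obtain V where V: "norm (V y) \<le> norm y" "2 ^ k * N (y - U y) \<le> N (y - V y)"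
      using ex[of k] by blast
    have "N (y - V y) \<le> norm y + norm (V y)"
      using Nle[of "y - V y"] norm_triangle_ineq4[of y "V y"] by linarith
    then show ?thesis using V by linarith
  qed
  show ?thesis
  proof (rule ccontr)
    assume "N (y - U y) \<noteq> 0"
    then have pos: "0 < N (y - U y)" using N0[of "y - U y"] by simp
    obtain k where "2 * norm y / N (y - U y) < 2 ^ k"
      using real_arch_pow[of 2 "2 * norm y / N (y - U y)"] by auto
    then show False using bound[of k] pos by (simp add: field_simps)
  qed
qed

text \<open>The hypothesis \<open>rest\<close> splits T = 1 - z/2 into c Q + R with Q = 1 - x/2 and
  R of norm at most 1 - c. The factor 1/2 makes Q the average of 1 and U = 1 - x, so N y \<le> N (Q
  y) is the doubling property of U.\<close>

lemma iterates_mult_tendsto_0: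
  fixes x z :: "'a::{real_normed_algebra,comm_ring}"
  assumes x: "\<And>y. norm (y - x * y) \<le> norm y" and c: "c > 0"
    and rest: "\<And>y. norm ((y - (1/2) *\<^sub>R (z * y)) - c *\<^sub>R (y - (1/2) *\<^sub>R (x * y))) \<le> (1 - c) * norm y"
  shows "(\<lambda>n. ((\<lambda>y. y - (1/2) *\<^sub>R (z * y)) ^^ n) (x * y)) \<longlonglongrightarrow> 0"
proof -
  define T where "T = (\<lambda>y. y - (1/2) *\<^sub>R (z * y))"
  define Q where "Q = (\<lambda>y. y - (1/2) *\<^sub>R (x * y))"
  define U where "U = (\<lambda>y. y - x * y)"
  define R where "R = (\<lambda>y. T y - c *\<^sub>R Q y)"
  have UQ: "y + U y = 2 *\<^sub>R Q y" for y by (simp add: U_def Q_def algebra_simps scaleR_2)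
  have Qnorm: "norm (Q y) \<le> norm y" for y
  proof -
    have "2 * norm (Q y) = norm (y + U y)" by (simp add: UQ)
    also have "\<dots> \<le> norm y + norm (U y)" by (rule norm_triangle_ineq)
    finally show ?thesis using x[of y] by (simp add: U_def)
  qed
  have Rnorm: "norm (R y) \<le> (1 - c) * norm y" for y using rest by (simp add: R_def T_def Q_def)
  have TQR: "T y = c *\<^sub>R Q y + R y" for y by (simp add: R_def)
  have Tnorm: "norm (T y) \<le> norm y" for y
  proof -
    have "norm (T y) \<le> norm (c *\<^sub>R Q y) + norm (R y)"
      unfolding TQR by (rule norm_triangle_ineq)
    also have "\<dots> \<le> c * norm y + (1 - c) * norm y"
      using c Qnorm[of y] Rnorm[of y] by (intro add_mono) (auto intro: mult_left_mono)
    finally show ?thesis by (simp add: algebra_simps)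
  qed
  have Tadd: "(T ^^ n) (u + v) = (T ^^ n) u + (T ^^ n) v" for n u v
    by (induction n) (simp_all add: T_def algebra_simps)
  have Tscale: "(T ^^ n) (r *\<^sub>R u) = r *\<^sub>R (T ^^ n) u" for n r u
    by (induction n) (simp_all add: T_def algebra_simps)
  \<comment> \<open>By commutativity the iterates of T commute with every multiplication, hence with
    U and R, so norm bounds on U and R become bounds for N.\<close>
  have Tmult: "(T ^^ n) (w * u) = w * (T ^^ n) u" for n w u
    by (induction n) (simp_all add: T_def algebra_simps)
  have Tdiff: "(T ^^ n) (u - v) = (T ^^ n) u - (T ^^ n) v" for n u v
    using Tadd[of n u "(-1) *\<^sub>R v"] Tscale[of n "-1" v] by simp
  have TU: "(T ^^ n) (U y) = U ((T ^^ n) y)" for n y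
    by (simp add: U_def Tdiff Tmult)
  have TR: "(T ^^ n) (R y) = R ((T ^^ n) y)" for n y
    by (simp add: R_def Q_def T_def[THEN fun_cong] Tdiff Tmult Tscale)
  \<comment> \<open>The limit exists because T is a contraction, so the norms decrease along the
    iteration.\<close>
  define N where "N = (\<lambda>y. lim (\<lambda>n. norm ((T ^^ n) y)))"
  have dec: "decseq (\<lambda>n. norm ((T ^^ n) y))" for y
    by (rule decseq_SucI) (simp add: Tnorm)
  have lim: "(\<lambda>n. norm ((T ^^ n) y)) \<longlonglongrightarrow> N y" for y
    unfolding N_def convergent_LIMSEQ_iff[symmetric]
    by (rule decseq_convergent[OF dec, of 0]) (auto simp: convergent_def)
  have Nle: "N y \<le> norm y" for y
    using decseq_ge[OF dec lim, of y 0] by simp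
  have N0: "0 \<le> N y" for y
    using lim by (rule LIMSEQ_le_const) auto
  have Nadd: "N (u + v) \<le> N u + N v" for u v
    by (rule LIMSEQ_le[OF lim tendsto_add[OF lim lim]]) (auto simp: Tadd norm_triangle_ineq)
  have Nscale: "N (r *\<^sub>R u) = \<bar>r\<bar> * N u" for r u
  proof (rule LIMSEQ_unique[OF lim])
    show "(\<lambda>n. norm ((T ^^ n) (r *\<^sub>R u))) \<longlonglongrightarrow> \<bar>r\<bar> * N u"
      using tendsto_mult_left[OF lim, of "\<bar>r\<bar>" u] by (simp add: Tscale)
  qed
  have NT: "N (T y) = N y" for y
  proof (rule LIMSEQ_unique[OF lim])
    show "(\<lambda>n. norm ((T ^^ n) (T y))) \<longlonglongrightarrow> N y"
      using LIMSEQ_Suc[OF lim[of y]] by (simp add: funpow_swap1)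
  qed
  have NU: "N (U y) \<le> N y" for y
    by (rule LIMSEQ_le[OF lim lim]) (use x in \<open>auto simp: TU, simp add: U_def\<close>)
  have NR: "N (R y) \<le> (1 - c) * N y" for y
    by (rule LIMSEQ_le[OF lim tendsto_mult_left[OF lim]]) (auto simp: TR Rnorm)
  \<comment> \<open>From N y = N (T y) \<le> c N (Q y) + (1 - c) N y, cancel (1 - c) N y and divide
    by c.\<close>
  have "N y \<le> N (Q y)" for y
  proof -
    have "N (T y) \<le> N (c *\<^sub>R Q y) + N (R y)" unfolding TQR by (rule Nadd)
    then have "N y \<le> c * N (Q y) + N (R y)" using c by (simp add: NT Nscale)
    also have "\<dots> \<le> c * N (Q y) + (N y - c * N y)" using NR[of y] by (simp add: algebra_simps)
    finally have "c * N y \<le> c * N (Q y)" by linarith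
    then show ?thesis using c by (simp only: mult_le_cancel_left_pos)
  qed
  then have "2 * N y \<le> N (y + U y)" for y by (simp add: UQ Nscale)
  moreover have "linear U" by (rule linearI) (simp_all add: U_def algebra_simps)
  ultimately have "N (y - U y) = 0"
    by (intro seminorm_doubling_vanishes[OF Nadd Nscale Nle N0 _ _ NU]) (auto simp: U_def x)
  then have "(\<lambda>n. norm ((T ^^ n) (x * y))) \<longlonglongrightarrow> 0"
    using lim[of "x * y"] by (simp add: U_def)
  then show ?thesis unfolding T_def by (rule tendsto_norm_zero_cancel)
qed

lemma mult_mem_principal_cl:
  fixes x z :: "'a::{real_normed_algebra,comm_ring}"
  assumes "\<And>y. norm (y - x * y) \<le> norm y" and "c > 0"
    and "\<And>y. norm ((y - (1/2) *\<^sub>R (z * y)) - c *\<^sub>R (y - (1/2) *\<^sub>R (x * y))) \<le> (1 - c) * norm y"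
  shows "x * y \<in> principal_cl z"
proof -
  define t where "t = (\<lambda>n. ((\<lambda>y. y - (1/2) *\<^sub>R (z * y)) ^^ n) (x * y))"
  \<comment> \<open>Each iteration subtracts (1/2) z (t n), so the cofactor of z grows by (1/2) t
    n.\<close>
  have "x * y - t n \<in> range ((*) z)" for n
  proof (induction n)
    case 0
    show ?case using rangeI[of "(*) z" 0] by (simp add: t_def)
  next
    case (Suc n)
    then obtain a where "x * y - t n = z * a" by blast
    then have "x * y - t (Suc n) = z * (a + (1/2) *\<^sub>R t n)"
      by (simp add: t_def algebra_simps)
    then show ?case by simp
  qed
  moreover have "(\<lambda>n. x * y - t n) \<longlonglongrightarrow> x * y - 0"
    unfolding t_def by (intro tendsto_diff tendsto_const iterates_mult_tendsto_0[OF assms])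
  ultimately show ?thesis
    unfolding principal_cl_def closure_sequential by (intro exI[of _ "\<lambda>n. x * y - t n"]) simp
qed

section \<open>Closed subspaces and closures of principal ideals\<close>

lemma subspace_closure:
  fixes S :: "'a::real_normed_vector set"
  assumes "subspace S"
  shows "subspace (closure S)"
proof (rule subspaceI)
  show "0 \<in> closure S" using assms closure_subset subspace_0 by blast
next
  fix u v assume "u \<in> closure S" "v \<in> closure S"
  then obtain f g where "\<And>n. f n \<in> S" "f \<longlonglongrightarrow> u" "\<And>n. g n \<in> S" "g \<longlonglongrightarrow> v"
    unfolding closure_sequential by blast
  then have "\<forall>n. f n + g n \<in> S" "(\<lambda>n. f n + g n) \<longlonglongrightarrow> u + v"
    using assms by (auto intro: subspace_add tendsto_add)
  then show "u + v \<in> closure S"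
    unfolding closure_sequential by (intro exI[of _ "\<lambda>n. f n + g n"]) simp
next
  fix r u assume "u \<in> closure S"
  then obtain f where "\<And>n. f n \<in> S" "f \<longlonglongrightarrow> u"
    unfolding closure_sequential by blast
  then have "\<forall>n. r *\<^sub>R f n \<in> S" "(\<lambda>n. r *\<^sub>R f n) \<longlonglongrightarrow> r *\<^sub>R u"
    using assms by (auto intro: subspace_scale tendsto_intros)
  then show "r *\<^sub>R u \<in> closure S"
    unfolding closure_sequential by (intro exI[of _ "\<lambda>n. r *\<^sub>R f n"]) simp
qed

lemma subspace_principal_cl: "subspace (principal_cl x)"
proof -
  have "linear ((*) x)" by (rule linearI) (simp_all add: algebra_simps)
  then have "subspace (range ((*) x))" by (simp add: linear_subspace_image)
  then show ?thesis unfolding principal_cl_def by (rule subspace_closure)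
qed

lemma principal_cl_subset:
  assumes "\<And>a. x * a \<in> S" "closed S"
  shows "principal_cl x \<subseteq> S"
  unfolding principal_cl_def using assms by (intro closure_minimal) auto

section \<open>Weighted series of elements of \<open>frakF\<close>\<close>

lemma frakF_norm_le:
  fixes cs :: "complex \<Rightarrow> 'a::{real_normed_algebra,comm_ring,banach} \<Rightarrow> 'a"
  assumes cs: "complex_scalar cs" and "approx_unital TYPE('a)" and x: "x \<in> frakF cs"
  shows "norm x \<le> 2"
proof -
  obtain F :: "'a filter" where F: "F \<noteq> bot" "F \<le> principal {e. norm e \<le> 1}"
      "((\<lambda>e. e * x) \<longlongrightarrow> x) F"
    using assms(2) unfolding approx_unital_def by blast
  \<comment> \<open>For e in the unit ball, norm (e x) \<le> norm e + norm (e - x e) \<le> 2, and e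
    x tends to x along the approximate identity.\<close>
  have "eventually (\<lambda>e. norm e \<le> 1) F" using F(2) by (simp add: le_principal)
  then have "eventually (\<lambda>e. norm (e * x) \<le> 2) F"
  proof eventually_elim
    case (elim e)
    have "norm (e * x) \<le> norm e + norm (e - x * e)"
      using norm_triangle_ineq4[of e "e - x * e"] by (simp add: mult.commute)
    also have "\<dots> \<le> 2" using elim x mem_frakF_iff[OF cs, of x] by (smt (verit))
    finally show ?case .
  qed
  then show ?thesis using F by (intro tendsto_upperbound[OF tendsto_norm[OF F(3)]])
qed

context
  fixes cs :: "complex \<Rightarrow> 'a::{real_normed_algebra,comm_ring,banach} \<Rightarrow> 'a" and x :: "nat \<Rightarrow> 'a"
  assumes cs: "complex_scalar cs" and au: "approx_unital TYPE('a)"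
    and x: "\<And>k. x k \<in> frakF cs"
begin

private lemma contr: "norm (y - x k * y) \<le> norm y"
  using x mem_frakF_iff[OF cs] by blast

text \<open>Indices start at 0 here, so \<open>x k\<close> carries the weight 2^-(k+1). These
  weights sum to 1, which makes z an infinite convex combination.\<close>

private definition z where "z = (\<Sum>k. (1/2) ^ Suc k *\<^sub>R x k)"

private lemma sums_z: "(\<lambda>k. (1/2) ^ Suc k *\<^sub>R x k) sums z"
proof -
  have "summable (\<lambda>k. (1/2::real) ^ k)" by (rule summable_geometric) simp
  moreover have "norm ((1/2) ^ Suc k *\<^sub>R x k) \<le> (1/2) ^ k" for k
    using frakF_norm_le[OF cs au x, of k] by simp
  ultimately have "summable (\<lambda>k. (1/2) ^ Suc k *\<^sub>R x k)"
    by (rule summable_comparison_test'[where N = 0])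
  then show ?thesis unfolding z_def by (rule summable_sums)
qed

private lemma sums_z_mult: "(\<lambda>k. (1/2) ^ Suc k *\<^sub>R (x k * y)) sums (z * y)"
  using sums_mult2[OF sums_z, of y] by simp

text \<open>As the weights sum to 1, they also average the operators 1 - t (x k) to 1 - t z. The
  case t = 1 gives membership of z in \<open>frakF\<close>, the case t = 1/2 the splitting of
  T.\<close>

private lemma sums_affine:
  "(\<lambda>k. (1/2) ^ Suc k *\<^sub>R (y - t *\<^sub>R (x k * y))) sums (y - t *\<^sub>R (z * y))"
proof -
  have "(\<lambda>k. (1/2) ^ Suc k *\<^sub>R y - t *\<^sub>R ((1/2) ^ Suc k *\<^sub>R (x k * y))) sums (1 *\<^sub>R y - t *\<^sub>R (z * y))"
    by (intro sums_diff sums_scaleR_left sums_scaleR_right sums_z_mult power_half_series)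
  then show ?thesis by (simp add: algebra_simps)
qed

lemma frakF_series_mem: "(\<Sum>k. (1/2) ^ Suc k *\<^sub>R x k) \<in> frakF cs"
proof -
  have "norm (y - z * y) \<le> norm y" for y
  proof -
    have "(\<lambda>k. (1/2) ^ Suc k * norm y) sums norm y"
      using sums_mult2[OF power_half_series, of "norm y"] by simp
    moreover have "norm ((1/2) ^ Suc k *\<^sub>R (y - 1 *\<^sub>R (x k * y))) \<le> (1/2) ^ Suc k * norm y" for k
      using contr[of y k] by (simp add: mult_left_mono)
    ultimately have "norm (\<Sum>k. (1/2) ^ Suc k *\<^sub>R (y - 1 *\<^sub>R (x k * y))) \<le> norm y"
      by (metis (no_types, lifting) norm_suminf_le sums_iff)
    then show ?thesis using sums_affine[of y 1] by (simp add: sums_iff)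
  qed
  then show ?thesis unfolding z_def[symmetric] by (simp add: mem_frakF_iff[OF cs])
qed

text \<open>In the convex combination 1 - z/2 of the contractions 1 - (x k)/2, the constant c is the
  weight of the j-th one; the others have total weight 1 - c.\<close>

lemma frakF_series_absorbs: "x j * y \<in> principal_cl (\<Sum>k. (1/2) ^ Suc k *\<^sub>R x k)"
  unfolding z_def[symmetric]
proof (rule mult_mem_principal_cl[OF contr])
  let ?c = "(1/2::real) ^ Suc j"
  show "?c > 0" by simp
  fix y
  define f where "f = (\<lambda>k. (1/2) ^ Suc k *\<^sub>R (y - (1/2) *\<^sub>R (x k * y)))"
  define g where "g = (\<lambda>k. (1/2) ^ Suc k * norm y)"
  have half: "norm (y - (1/2) *\<^sub>R (x k * y)) \<le> norm y" for k
  proof -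
    have "2 *\<^sub>R (y - (1/2) *\<^sub>R (x k * y)) = y + (y - x k * y)" by (simp add: algebra_simps scaleR_2)
    then have "2 * norm (y - (1/2) *\<^sub>R (x k * y)) = norm (y + (y - x k * y))"
      by (metis abs_numeral norm_scaleR)
    also have "\<dots> \<le> norm y + norm (y - x k * y)" by (rule norm_triangle_ineq)
    finally show ?thesis using contr[of y k] by simp
  qed
  \<comment> \<open>Removing the j-th term from the series and from its majorant leaves a termwise
    comparison in which the majorant sums to (1 - c) norm y.\<close>
  have f: "(\<lambda>k. f k - (if k = j then f k else 0)) sums ((y - (1/2) *\<^sub>R (z * y)) - f j)"
    unfolding f_def by (intro sums_diff sums_affine sums_single)
  have "g sums norm y"
    unfolding g_def using sums_mult2[OF power_half_series, of "norm y"] by simp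
  then have g: "(\<lambda>k. g k - (if k = j then g k else 0)) sums (norm y - g j)"
    by (intro sums_diff sums_single)
  have "norm (f k - (if k = j then f k else 0)) \<le> g k - (if k = j then g k else 0)" for k
    using half[of k] by (simp add: f_def g_def mult_left_mono)
  then have "norm (\<Sum>k. f k - (if k = j then f k else 0)) \<le> (\<Sum>k. g k - (if k = j then g k else 0))"
    by (rule norm_suminf_le[OF _ sums_summable[OF g]])
  then have "norm ((y - (1/2) *\<^sub>R (z * y)) - f j) \<le> norm y - g j"
    using f g by (simp add: sums_iff)
  then show "norm ((y - (1/2) *\<^sub>R (z * y)) - ?c *\<^sub>R (y - (1/2) *\<^sub>R (x j * y))) \<le> (1 - ?c) * norm y"
    by (simp add: f_def g_def algebra_simps)
qed

lemma frakF_series_principal_subset: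
  assumes "subspace S" "closed S" and S: "\<And>k a. x k * a \<in> S"
  shows "principal_cl (\<Sum>k. (1/2) ^ Suc k *\<^sub>R x k) \<subseteq> S"
  unfolding z_def[symmetric]
proof (rule principal_cl_subset[OF _ \<open>closed S\<close>])
  fix a
  have "(\<Sum>k<n. (1/2) ^ Suc k *\<^sub>R (x k * a)) \<in> S" for n
    using assms by (intro subspace_sum subspace_scale) auto
  then show "z * a \<in> S"
    by (rule closed_sequentially[OF \<open>closed S\<close> _ sums_z_mult[unfolded sums_def]])
qed

end

section \<open>Separable ideals as closed principal ideals, and closed sums of principal
  ideals\<close>

theorem theorem7p2:
  fixes cs :: "complex \<Rightarrow> 'a::{real_normed_algebra,comm_ring,banach} \<Rightarrow> 'a"
  assumes "complex_scalar cs"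
    and "approx_unital TYPE('a)"
  shows "(\<forall>J. closed_ideal cs J \<and> separable_set J \<and> has_bai_in J (frakr cs) \<longrightarrow>
            (\<exists>x\<in>frakF cs. J = principal_cl x))
       \<and> (\<forall>x :: nat \<Rightarrow> 'a. (\<forall>k\<ge>1. x k \<in> frakF cs) \<longrightarrow>
            closure {sum y S | S y. finite S \<and> S \<subseteq> {1..} \<and> (\<forall>k\<in>S. y k \<in> principal_cl (x k))}
            = principal_cl (\<Sum>k. scaleR ((1/2) ^ Suc k) (x (Suc k))))"
proof (intro conjI allI impI)
  note cs = assms(1) and au = assms(2)
  fix J assume "closed_ideal cs J \<and> separable_set J \<and> has_bai_in J (frakr cs)"
  then have J: "closed_ideal cs J" and sep: "separable_set J" and bai: "has_bai_in J (frakr cs)"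
    by auto
  have J0: "0 \<in> J" and Jadd: "\<And>u v. u \<in> J \<Longrightarrow> v \<in> J \<Longrightarrow> u + v \<in> J"
    and Jcs: "\<And>c u. u \<in> J \<Longrightarrow> cs c u \<in> J" and Jmult: "\<And>a u. u \<in> J \<Longrightarrow> a * u \<in> J \<and> u * a \<in> J"
    and Jcl: "closed J"
    using J unfolding closed_ideal_def by blast+
  have Jsub: "subspace J"
  proof (rule subspaceI)
    show "r *\<^sub>R u \<in> J" if "u \<in> J" for r u
      using Jcs[OF that, of "complex_of_real r"] cs unfolding complex_scalar_def by metis
  qed (use J0 Jadd in auto)
  obtain D where D: "countable D" "D \<subseteq> J" "J \<subseteq> closure D"
    using sep unfolding separable_set_def by blast
  have "D \<noteq> {}" using D J0 by auto
  then have rD: "range (from_nat_into D) = D" using D(1) by (simp add: range_from_nat_into)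
  \<comment> \<open>Choose u from the approximate identity with u d near d and set b = u / (1 + u).
    Then b = u - u b lies in J, and b (d + u d) = u d shows that a multiple of b is near d.\<close>
  have approx: "\<exists>b. b \<in> frakF cs \<and> b \<in> J \<and> (\<exists>a. dist (b * a) d < e)" if d: "d \<in> J" and e: "e > 0" for d and e :: real
  proof -
    obtain F :: "'a filter" and M where F: "F \<noteq> bot"
        "F \<le> principal (J \<inter> frakr cs \<inter> {e. norm e \<le> M})" "((\<lambda>e. e * d) \<longlongrightarrow> d) F"
      using bai d unfolding has_bai_in_def by blast
    have "eventually (\<lambda>u. u \<in> J \<inter> frakr cs \<inter> {e. norm e \<le> M}) F" using F(2) by (simp only: le_principal)
    with tendstoD[OF F(3) e] have "eventually (\<lambda>u. u \<in> J \<and> u \<in> frakr cs \<and> dist (u * d) d < e) F"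
      by eventually_elim auto
    then obtain u where u: "u \<in> J" "u \<in> frakr cs" "dist (u * d) d < e"
      using F(1) eventually_happens' by blast
    obtain b where b: "b \<in> frakF cs" "b + u * b = u"
      using frakr_quotient_in_frakF[OF cs u(2)] by blast
    have "b = u - u * b" using b(2) by (simp add: eq_diff_eq)
    then have "b \<in> J" using u(1) Jmult[OF u(1)] subspace_diff[OF Jsub] by metis
    moreover have "b * (d + u * d) = (b + u * b) * d" by (simp add: algebra_simps)
    ultimately show ?thesis using b u(3) by metis
  qed
  \<comment> \<open>One generator is chosen for each dense point and each tolerance 1/(n+1);
    \<open>prod_decode\<close> lists these pairs as a single sequence.\<close>
  have "\<forall>i. \<exists>b. b \<in> frakF cs \<and> b \<in> J \<and>
      (\<exists>a. dist (b * a) (from_nat_into D (fst (prod_decode i))) < inverse (real (Suc (snd (prod_decode i)))))"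
    using rD D(2) by (intro allI approx) auto
  then obtain x where x: "\<And>i. x i \<in> frakF cs" "\<And>i. x i \<in> J"
      "\<And>i. \<exists>a. dist (x i * a) (from_nat_into D (fst (prod_decode i))) < inverse (real (Suc (snd (prod_decode i))))"
    by metis
  define z where "z = (\<Sum>k. (1/2) ^ Suc k *\<^sub>R x k)"
  have "principal_cl z \<subseteq> J"
    unfolding z_def using Jsub Jcl Jmult x(2)
    by (intro frakF_series_principal_subset[OF cs au x(1)]) auto
  moreover have "D \<subseteq> principal_cl z"
  proof
    fix d assume "d \<in> D"
    then obtain i where i: "from_nat_into D i = d" using rD by (metis imageE)
    have "\<exists>v\<in>principal_cl z. dist v d < e" if e: "e > 0" for e :: real
    proof -
      obtain n where n: "inverse (real (Suc n)) < e" using reals_Archimedean[OF e] by blast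
      obtain a where "dist (x (prod_encode (i, n)) * a) d < inverse (real (Suc n))"
        using x(3)[of "prod_encode (i, n)"] i by auto
      then show ?thesis using frakF_series_absorbs[OF cs au x(1)] n
        unfolding z_def by (meson order_less_trans)
    qed
    then have "d \<in> closure (principal_cl z)" by (simp add: closure_approachable)
    then show "d \<in> principal_cl z" by (simp add: principal_cl_def)
  qed
  then have "J \<subseteq> principal_cl z"
    using D(3) closure_minimal[of D "principal_cl z"] by (auto simp: principal_cl_def)
  moreover have "z \<in> frakF cs" unfolding z_def by (rule frakF_series_mem[OF cs au x(1)])
  ultimately show "\<exists>x\<in>frakF cs. J = principal_cl x" by blast
next
  note cs = assms(1) and au = assms(2)
  fix x :: "nat \<Rightarrow> 'a" assume "\<forall>k\<ge>1. x k \<in> frakF cs"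
  then have x: "\<And>k. x (Suc k) \<in> frakF cs" by simp
  let ?E = "{sum y S | S y. finite S \<and> S \<subseteq> {1..} \<and> (\<forall>k\<in>S. y k \<in> principal_cl (x k))}"
  let ?z = "\<Sum>k. (1/2) ^ Suc k *\<^sub>R x (Suc k)"
  have gen: "x (Suc k) * a \<in> ?E" for k a
  proof -
    have "x (Suc k) * a \<in> principal_cl (x (Suc k))"
      unfolding principal_cl_def by (rule subsetD[OF closure_subset]) (rule rangeI)
    then have "finite {Suc k} \<and> {Suc k} \<subseteq> {1..} \<and> (\<forall>i\<in>{Suc k}. x (Suc k) * a \<in> principal_cl (x i))"
      by simp
    then show ?thesis
      by (intro CollectI exI[of _ "{Suc k}"] exI[of _ "\<lambda>i. x (Suc k) * a"]) simp
  qed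
  have "subspace ?E"
  proof (rule subspaceI)
    show "0 \<in> ?E" by (intro CollectI exI[of _ "{}"]) auto
  next
    fix u v assume "u \<in> ?E" "v \<in> ?E"
    then obtain S y S' y' where S: "u = sum y S" "finite S" "S \<subseteq> {1..}" "\<forall>k\<in>S. y k \<in> principal_cl (x k)"
      and S': "v = sum y' S'" "finite S'" "S' \<subseteq> {1..}" "\<forall>k\<in>S'. y' k \<in> principal_cl (x k)"
      by auto
    \<comment> \<open>Extending both families by 0 merges them over \<open>S \<union> S'\<close>;
      each term stays in its own \<open>principal_cl (x k)\<close>, which is a subspace.\<close>
    define w where "w = (\<lambda>k. (if k \<in> S then y k else 0) + (if k \<in> S' then y' k else 0))"
    have "u + v = sum w (S \<union> S')"
      using S(1,2) S'(1,2) by (simp add: w_def sum.distrib sum.If_cases Int_absorb1)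
    moreover have "w k \<in> principal_cl (x k)" for k
      using S(4) S'(4) subspace_principal_cl[of "x k"]
      by (auto simp: w_def intro: subspace_add subspace_0)
    ultimately show "u + v \<in> ?E"
      using S S' by (intro CollectI exI[of _ "S \<union> S'"] exI[of _ w]) auto
  next
    fix r u assume "u \<in> ?E"
    then obtain S y where "u = sum y S" "finite S" "S \<subseteq> {1..}" "\<forall>k\<in>S. y k \<in> principal_cl (x k)"
      by auto
    then show "r *\<^sub>R u \<in> ?E"
      by (intro CollectI exI[of _ S] exI[of _ "\<lambda>k. r *\<^sub>R y k"])
        (auto simp: scaleR_sum_right intro: subspace_scale subspace_principal_cl)
  qed
  \<comment> \<open>The closure of a subspace is a closed subspace, and it contains every x (k+1) a,
    hence also the limits of weighted sums of these.\<close>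
  then have "principal_cl ?z \<subseteq> closure ?E"
    by (intro frakF_series_principal_subset[OF cs au x] subspace_closure closed_closure
        subsetD[OF closure_subset gen])
  moreover have "?E \<subseteq> principal_cl ?z"
  proof clarify
    fix S y assume S: "finite S" "S \<subseteq> {1..}" "\<forall>k\<in>S. y k \<in> principal_cl (x k)"
    have "principal_cl (x k) \<subseteq> principal_cl ?z" if "k \<in> S" for k
    proof -
      \<comment> \<open>The series runs over the shifted sequence, so an index k \<ge> 1 sits at
        position k - 1.\<close>
      have "k = Suc (k - 1)" using S(2) that by auto
      then have "x k * a \<in> principal_cl ?z" for a
        using frakF_series_absorbs[of cs "\<lambda>k. x (Suc k)" "k - 1" a] cs au x by metis
      then show ?thesis by (intro principal_cl_subset) (simp_all add: principal_cl_def)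
    qed
    then show "sum y S \<in> principal_cl ?z"
      using S(3) by (intro subspace_sum[OF subspace_principal_cl]) auto
  qed
  then have "closure ?E \<subseteq> principal_cl ?z"
    by (intro closure_minimal) (auto simp: principal_cl_def)
  ultimately show "closure ?E = principal_cl ?z" by blast
qed

end
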